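(* We have \[ A^*E_iV\subseteq E_{i-1}V+E_iV+E_{i+1}V\qquad(0\le i\le N). \]
   Context: Let $q$ be a prime power, $GF(q)$ the field with $q$ elements, $N\ge 1$ an integer, and $\mathbf V$ an $N$-dimensional vector space over $GF(q)$. Let $X$ be the set of all subspaces of $\mathbf V$, ordered by inclusion (the projective geometry $L_N(q)$). For $y,z\in X$, $y$ covers $z$ means $z\subseteq y$ and $\dim y-\dim z=1$. ${\rm Mat}_X(\mathbb C)$ is the algebra of complex matrices with rows and columns indexed by $X$; it acts on $V=\mathbb C^X$ by left multiplication. $A^*\in{\rm Mat}_X(\mathbb C)$ is the diagonal matrix with $(y,y)$-entry $q^{-\dim y}$. Fix a real number $\varphi>0$. The matrix $A\in{\rm Mat}_X(\mathbb C)$ has $(y,z)$-entry $1$ if $y$ covers $z$; $\varphi q^{\dim y}$ if $z$ covers $y$; $\frac{\varphi-1}{q-1}q^{\dim y}$ if $y=z$; and $0$ otherwise. It is a fact that $A$ is diagonalizable with the mutually distinct eigenvalues $\theta_i=\frac{\varphi q^{N-i}-q^i}{q-1}$ $(0\le i\le N)$. For $0\le i\le N$, $E_i\in{\rm Mat}_X(\mathbb C)$ acts as the identity on the $\theta_i$-eigenspace of $A$ and as $0$ on every other eigenspace of $A$; also $E_{-1}=0$ and $E_{N+1}=0$. *)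

theory Defs
  imports "HOL-Analysis.Analysis" "HOL-Library.Set_Algebras"
begin

text \<open>
  A vector space over a finite field is given by its scalar multiplication \<open>s\<close>.
  Matrices over the poset \<open>X\<close> of all its subspaces are matrices \<open>complex ^ 'x ^ 'x\<close>, where a
  finite index type \<open>'x\<close> enumerates the subspaces through a bijection
  \<open>U :: 'x \<Rightarrow> 'v set\<close> onto \<open>subspaces s\<close>. The entry in row \<open>y\<close> and column \<open>z\<close> of \<open>M\<close> is \<open>M $ y $ z\<close>.
\<close>

definition subspaces :: "('a::field \<Rightarrow> 'v::ab_group_add \<Rightarrow> 'v) \<Rightarrow> 'v set set" where
  "subspaces s = {S. module.subspace s S}"

definition covers :: "('a::field \<Rightarrow> 'v::ab_group_add \<Rightarrow> 'v) \<Rightarrow> 'v set \<Rightarrow> 'v set \<Rightarrow> bool" where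
  "covers s y z \<longleftrightarrow> z \<subseteq> y \<and> vector_space.dim s y = vector_space.dim s z + 1"

definition A_dual ::
  "('a::field \<Rightarrow> 'v::ab_group_add \<Rightarrow> 'v) \<Rightarrow> ('x::finite \<Rightarrow> 'v set) \<Rightarrow> nat \<Rightarrow> complex ^ 'x ^ 'x" where
  "A_dual s U q =
    (\<chi> y z. if y = z then 1 / of_nat q ^ vector_space.dim s (U y) else 0)"

definition A_mat ::
  "('a::field \<Rightarrow> 'v::ab_group_add \<Rightarrow> 'v) \<Rightarrow> ('x::finite \<Rightarrow> 'v set) \<Rightarrow> nat \<Rightarrow> real \<Rightarrow> complex ^ 'x ^ 'x" where
  "A_mat s U q \<phi> =
    (\<chi> y z. if covers s (U y) (U z) then 1
            else if covers s (U z) (U y) then of_real (\<phi> * real q ^ vector_space.dim s (U y))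
            else if y = z then
              of_real ((\<phi> - 1) / (real q - 1) * real q ^ vector_space.dim s (U y))
            else 0)"

definition theta :: "nat \<Rightarrow> real \<Rightarrow> nat \<Rightarrow> nat \<Rightarrow> real" where
  "theta q \<phi> N i = (\<phi> * real q ^ (N - i) - real q ^ i) / (real q - 1)"

definition eigenspace :: "complex ^ 'x ^ 'x \<Rightarrow> complex \<Rightarrow> (complex ^ 'x::finite) set" where
  "eigenspace M t = {v. M *v v = t *s v}"

text \<open>
  For diagonalizable \<open>M\<close> the following determines \<open>P\<close> uniquely. If \<open>t'\<close> is not an eigenvalue then
  \<open>eigenspace M t'\<close> is zero, so \<open>t'\<close> effectively ranges over the other eigenvalues.
\<close>

definition eigenprojection ::
  "complex ^ 'x ^ 'x \<Rightarrow> complex \<Rightarrow> complex ^ 'x ^ 'x::finite \<Rightarrow> bool" where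
  "eigenprojection M t P \<longleftrightarrow>
    (\<forall>v \<in> eigenspace M t. P *v v = v) \<and>
    (\<forall>t'. t' \<noteq> t \<longrightarrow> (\<forall>v \<in> eigenspace M t'. P *v v = 0))"

end

theory Submission
  imports Defs
begin

text \<open>
  For a subspace \<open>W\<close> of dimension \<open>w\<close> and a scalar \<open>a \<noteq> 0\<close> let \<open>f\<^sub>W\<close> be the vector with entry
  \<open>a ^ dim y\<close> at the subspaces \<open>y\<close> of \<open>W\<close> and 0 elsewhere. If \<open>\<phi> a\<^sup>2 = (\<phi> - 1) a + 1\<close>, that is
  \<open>a = 1\<close> or \<open>a = - 1 / \<phi>\<close>, then \<open>A\<close> maps \<open>f\<^sub>W\<close> to \<open>\<theta> f\<^sub>W\<close> plus a multiple of the sum of the \<open>f\<close> of the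
  covers of \<open>W\<close>, where \<open>\<theta>\<close> has index \<open>N - w\<close> if \<open>a = 1\<close> and \<open>w\<close> if \<open>a = - 1 / \<phi>\<close>. The dual matrix maps
  \<open>f\<^sub>W\<close> into the span of \<open>f\<^sub>W\<close> and the \<open>f\<close> of the subspaces covered by \<open>W\<close>.

  So the spans of the \<open>f\<^sub>W\<close> with \<open>dim W \<ge> k\<close> form two flags, one for each \<open>a\<close>. Because the eigenvalues
  are distinct, they consist of the sums \<open>E\<^sub>0V + ... + E\<^sub>jV\<close> and \<open>E\<^sub>jV + ... + E\<^sub>NV\<close>; in particular \<open>A\<close> is
  diagonalizable. The dual matrix moves each flag by at most one step, and the image of \<open>E\<^sub>iV\<close> lies in
  the intersection of \<open>E\<^sub>0V + ... + E\<^bsub>i+1\<^esub>V\<close> and \<open>E\<^bsub>i-1\<^esub>V + ... + E\<^sub>NV\<close>.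
\<close>

section \<open>Counting subspaces over a finite field\<close>

locale finite_field_space = finite_dimensional_vector_space s B
  for s :: "'a::{field,finite} \<Rightarrow> 'v::ab_group_add \<Rightarrow> 'v" and B
begin

abbreviation "dm \<equiv> vector_space.dim s"

text \<open>Adjoining \<open>b\<close> outside \<open>span C\<close> multiplies the cardinality by
  \<open>CARD('a)\<close>: each vector of the larger span is \<open>s c b + x\<close> for exactly
  one \<open>c\<close> and one \<open>x\<close> in \<open>span C\<close>.\<close>

lemma card_span_independent:
  assumes "finite C" "independent C"
  shows "finite (span C) \<and> card (span C) = CARD('a) ^ card C"
  using assms
proof (induction C rule: finite_induct)
  case empty
  then show ?case by simp
next
  case (insert b C)
  then have ind: "independent C" and b: "b \<notin> span C"
    using independent_insert by auto
  have IH: "finite (span C)" "card (span C) = CARD('a) ^ card C"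
    using insert.IH[OF ind] by auto
  let ?f = "\<lambda>(c, x). s c b + x"
  have inj: "inj_on ?f (UNIV \<times> span C)"
  proof (rule inj_onI, clarify)
    fix c x c' x'
    assume x: "x \<in> span C" "x' \<in> span C" and eq: "s c b + x = s c' b + x'"
    have "s (c - c') b = x' - x"
      using eq by (simp add: scale_left_diff_distrib algebra_simps)
    then have "s (c - c') b \<in> span C"
      using x by (simp add: span_diff)
    then have "c - c' = 0"
      using b span_scale[of "s (c - c') b" C "inverse (c - c')"] by (metis left_inverse scale_one scale_scale)
    then have "c = c'" by simp
    then show "c = c' \<and> x = x'"
      using eq by simp
  qed
  have im: "?f ` (UNIV \<times> span C) = span (insert b C)"
  proof safe
    fix c x assume "x \<in> span C"
    then show "s c b + x \<in> span (insert b C)"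
      by (meson insertI1 span_add span_base span_mono span_scale subset_insertI subsetD)
  next
    fix y assume "y \<in> span (insert b C)"
    then obtain c where "y - s c b \<in> span C"
      using span_breakdown_eq by blast
    then have "y = ?f (c, y - s c b)" "(c, y - s c b) \<in> UNIV \<times> span C"
      by auto
    then show "y \<in> ?f ` (UNIV \<times> span C)"
      by (rule image_eqI)
  qed
  have "finite (span (insert b C))"
    using IH(1) unfolding im[symmetric] by simp
  moreover have "card (span (insert b C)) = CARD('a) * card (span C)"
    using card_image[OF inj] unfolding im by (simp add: card_cartesian_product)
  ultimately show ?case
    using IH insert.hyps by simp
qed

lemma card_subspace:
  assumes "subspace S"
  shows "finite S" "card S = CARD('a) ^ dm S"
proof -
  obtain C where C: "C \<subseteq> S" "independent C" "S \<subseteq> span C" "card C = dm S"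
    using basis_exists by blast
  have "S = span C"
    using C assms span_minimal by blast
  then show "finite S" "card S = CARD('a) ^ dm S"
    using card_span_independent[of C] C finiteI_independent by auto
qed

lemma card_field_ge_2: "CARD('a) \<ge> 2"
  using card_mono[of "UNIV :: 'a set" "{0, 1}"] by simp

lemma dim_subspace_insert:
  assumes "subspace Y" "v \<notin> Y"
  shows "dm (span (insert v Y)) = dm Y + 1"
proof -
  have "v \<notin> span Y"
    using assms by (metis span_eq_iff)
  then show ?thesis
    using dim_insert[of v Y] by simp
qed

lemma dim_less_if_psubset:
  assumes "subspace Y" "subspace Z" "Y \<subset> Z"
  shows "dm Y < dm Z"
  using assms subspace_dim_equal[of Y Z] by force

text \<open>A vector \<open>v\<close> of \<open>W - Y\<close> lies in exactly one such cover, namely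
  \<open>span (insert v Y)\<close>. So the differences \<open>Z - Y\<close> partition
  \<open>W - Y\<close> into blocks of equal size.\<close>

lemma card_upper_covers:
  assumes Y: "subspace Y" and W: "subspace W" and YW: "Y \<subseteq> W"
  shows "real (card {Z. subspace Z \<and> Y \<subseteq> Z \<and> Z \<subseteq> W \<and> dm Z = dm Y + 1}) * (real CARD('a) - 1)
    = real CARD('a) ^ (dm W - dm Y) - 1"
proof -
  define q where "q = CARD('a)"
  have q: "q \<ge> 2" using card_field_ge_2 q_def by simp
  let ?C = "{Z. subspace Z \<and> Y \<subseteq> Z \<and> Z \<subseteq> W \<and> dm Z = dm Y + 1}"
  have Z_eq: "Z = span (insert v Y)" if "Z \<in> ?C" "v \<in> Z - Y" for Z v
    using that dim_subspace_insert[OF Y, of v]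
    by (intro subspace_dim_equal[symmetric] span_minimal) auto
  have "W - Y = (\<Union>Z\<in>?C. Z - Y)"
  proof safe
    fix v assume v: "v \<in> W" "v \<notin> Y"
    have "span (insert v Y) \<in> ?C"
      using v W YW dim_subspace_insert[OF Y v(2)] span_superset[of "insert v Y"]
        span_minimal[of "insert v Y" W]
      unfolding mem_Collect_eq by (intro conjI subspace_span) auto
    moreover have "v \<in> span (insert v Y) - Y"
      using v by (simp add: span_base)
    ultimately show "v \<in> (\<Union>Z\<in>?C. Z - Y)"
      by (rule UN_I)
  qed auto
  moreover have "card (\<Union>Z\<in>?C. Z - Y) = (\<Sum>Z\<in>?C. card (Z - Y))"
  proof (rule card_UN_disjoint)
    show "finite ?C"
      using card_subspace(1)[OF W] by (auto intro: finite_subset[of _ "Pow W"])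
    show "\<forall>Z\<in>?C. finite (Z - Y)"
      using card_subspace(1) by blast
    show "\<forall>Z\<in>?C. \<forall>Z'\<in>?C. Z \<noteq> Z' \<longrightarrow> (Z - Y) \<inter> (Z' - Y) = {}"
      using Z_eq by (metis (no_types, lifting) disjoint_iff)
  qed
  ultimately have "card (W - Y) = (\<Sum>Z\<in>?C. card (Z - Y))"
    by (simp only:)
  also have "\<dots> = (\<Sum>Z\<in>?C. q ^ (dm Y + 1) - q ^ dm Y)"
    using Y card_subspace by (intro sum.cong) (auto simp: card_Diff_subset q_def)
  also have "card (W - Y) = q ^ dm W - q ^ dm Y"
    using Y W YW card_subspace by (auto simp: card_Diff_subset q_def)
  finally have "q ^ dm W - q ^ dm Y = card ?C * (q ^ (dm Y + 1) - q ^ dm Y)"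
    by simp
  then have "real (q ^ dm W - q ^ dm Y) = real (card ?C * (q ^ (dm Y + 1) - q ^ dm Y))"
    by simp
  moreover have le: "dm Y \<le> dm W" using YW by (rule dim_subset)
  moreover have "q ^ dm Y \<le> q ^ dm W" 
    using le q by (intro power_increasing) auto
  ultimately have "real q ^ dm W - real q ^ dm Y = real (card ?C) * (real q ^ (dm Y + 1) - real q ^ dm Y)"
    using q by (simp add: of_nat_diff)
  moreover have "real q ^ dm W = real q ^ dm Y * real q ^ (dm W - dm Y)"
    using le by (simp flip: power_add)
  ultimately have "real q ^ dm Y * (real q ^ (dm W - dm Y) - 1) = real q ^ dm Y * (real (card ?C) * (real q - 1))"
    by (simp add: algebra_simps)
  then show ?thesis
    using q by (simp add: q_def)
qed

text \<open>
  The induction counts the pairs of a vector of \<open>W - Y\<close> and a hyperplane of \<open>W\<close> containing it and \<open>Y\<close>.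
  For \<open>dim W = dim Y + 1\<close> the count only gives \<open>0 = 0\<close>, hence the separate case.
\<close>

lemma card_lower_covers:
  assumes Y: "subspace Y" and W: "subspace W" and YW: "Y \<subseteq> W"
  shows "real (card {H. subspace H \<and> Y \<subseteq> H \<and> H \<subseteq> W \<and> dm W = dm H + 1}) * (real CARD('a) - 1)
    = real CARD('a) ^ (dm W - dm Y) - 1"
  using Y YW
proof (induction "dm W - dm Y" arbitrary: Y)
  case 0
  then have "Y = W"
    using W by (intro subspace_dim_equal) auto
  then have "{H. subspace H \<and> Y \<subseteq> H \<and> H \<subseteq> W \<and> dm W = dm H + 1} = {}"
    by auto
  then show ?case using \<open>Y = W\<close> by (simp only:) simp
next
  case (Suc n)
  define q where "q = CARD('a)"
  have q: "q \<ge> 2" using card_field_ge_2 q_def by simp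
  let ?C = "\<lambda>Y. {H. subspace H \<and> Y \<subseteq> H \<and> H \<subseteq> W \<and> dm W = dm H + 1}"
  show ?case
  proof (cases "n = 0")
    case True
    have "?C Y = {Y}"
      using Suc.prems Suc.hyps(2) True by (auto dest!: subspace_dim_equal[of Y])
    moreover have "dm W - dm Y = 1" using Suc.hyps(2) True by simp
    ultimately show ?thesis by simp
  next
    case False
    have fin: "finite (?C Y)"
      using card_subspace(1)[OF W] by (auto intro: finite_subset[of _ "Pow W"])
    have finW: "finite W" "finite Y" using card_subspace Suc.prems W by auto
    have "(\<Sum>H\<in>?C Y. card {v \<in> W - Y. v \<in> H}) = (\<Sum>v\<in>W - Y. card {H \<in> ?C Y. v \<in> H})"
      using fin finW by (intro sum_multicount_gen[symmetric]) auto
    then have "(\<Sum>H\<in>?C Y. real (card {v \<in> W - Y. v \<in> H})) = (\<Sum>v\<in>W - Y. real (card {H \<in> ?C Y. v \<in> H}))"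
      by (metis (mono_tags, lifting) of_nat_sum sum.cong)
    moreover have "(\<Sum>H\<in>?C Y. real (card {v \<in> W - Y. v \<in> H})) = real (card (?C Y)) * (real q ^ (dm W - 1) - real q ^ dm Y)"
    proof -
      have "real (card {v \<in> W - Y. v \<in> H}) = real q ^ (dm W - 1) - real q ^ dm Y" if H: "H \<in> ?C Y" for H
      proof -
        have "{v \<in> W - Y. v \<in> H} = H - Y" using H by auto
        moreover have "card Y \<le> card H" 
          using H card_subspace(1) by (auto intro: card_mono)
        ultimately show ?thesis
          using H Suc.prems card_subspace by (auto simp: card_Diff_subset q_def of_nat_diff)
      qed
      then have "(\<Sum>H\<in>?C Y. real (card {v \<in> W - Y. v \<in> H})) = (\<Sum>H\<in>?C Y. real q ^ (dm W - 1) - real q ^ dm Y)"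
        by (rule sum.cong[OF refl])
      then show ?thesis
        by (simp only: sum_constant)
    qed
    moreover have "(\<Sum>v\<in>W - Y. real (card {H \<in> ?C Y. v \<in> H})) * (real q - 1) = (real q ^ dm W - real q ^ dm Y) * (real q ^ n - 1)"
    proof -
      have "real (card {H \<in> ?C Y. v \<in> H}) * (real q - 1) = real q ^ n - 1" if v: "v \<in> W - Y" for v
      proof -
        \<comment> \<open>A hyperplane of \<open>W\<close> contains \<open>Y\<close> and
          \<open>v\<close> iff it contains their span, which has codimension \<open>n\<close> in
          \<open>W\<close>; the induction hypothesis counts these.\<close>
        let ?Y = "span (insert v Y)"
        have "Y \<subseteq> H \<and> v \<in> H \<longleftrightarrow> ?Y \<subseteq> H" if "subspace H" for H
          using span_minimal[OF _ that, of "insert v Y"] span_superset[of "insert v Y"] by blast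
        then have "{H \<in> ?C Y. v \<in> H} = ?C ?Y"
          by blast
        moreover have "n = dm W - dm ?Y"
          using dim_subspace_insert[of Y v] Suc.prems v Suc.hyps(2) by simp
        moreover have "?Y \<subseteq> W" using v W Suc.prems by (intro span_minimal) auto
        ultimately show ?thesis
          using Suc.hyps(1)[of ?Y] by (simp add: q_def)
      qed
      moreover have "real (card (W - Y)) = real q ^ dm W - real q ^ dm Y"
        using Suc.prems W finW card_subspace card_mono[OF finW(1) Suc.prems(2)] 
        by (simp add: card_Diff_subset q_def of_nat_diff)
      ultimately show ?thesis by (simp add: sum_distrib_right)
    qed
    ultimately have "real (card (?C Y)) * (real q ^ (dm W - 1) - real q ^ dm Y) * (real q - 1)
       = (real q ^ dm W - real q ^ dm Y) * (real q ^ n - 1)"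
      by (simp only:)
    then have eq: "real (card (?C Y)) * (real q - 1) * (real q ^ (dm W - 1) - real q ^ dm Y)
       = (real q ^ dm W - real q ^ dm Y) * (real q ^ n - 1)"
      by (simp only: ac_simps)
    have w: "dm W = dm Y + Suc n" using Suc.hyps(2) by simp
    have "real q ^ n > 1" using q False by (intro one_less_power) auto
    then have "real q ^ dm Y * (real q ^ n - 1) \<noteq> 0" using q by auto
    moreover have "real q ^ (dm W - 1) - real q ^ dm Y = real q ^ dm Y * (real q ^ n - 1)"
      and "real q ^ dm W - real q ^ dm Y = (real q ^ Suc n - 1) * real q ^ dm Y"
      unfolding w by (simp_all add: algebra_simps power_add)
    then have "real (card (?C Y)) * (real q - 1) * (real q ^ dm Y * (real q ^ n - 1))
       = (real q ^ Suc n - 1) * (real q ^ dm Y * (real q ^ n - 1))"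
      using eq by (simp only: mult.assoc)
    ultimately have "real (card (?C Y)) * (real q - 1) = real q ^ Suc n - 1"
      by (simp only: mult_cancel_right) blast
    then show ?thesis using w by (simp add: q_def)
  qed
qed

text \<open>The only candidates are \<open>Y \<inter> W\<close> on the left and the sum of
  \<open>Y\<close> and \<open>W\<close> on the right, and the dimension formula admits both or
  neither. This handles the entries of \<open>A f\<^sub>W\<close> outside the support of
  \<open>f\<^sub>W\<close>.\<close>

lemma card_covers_transfer:
  assumes Y: "subspace Y" and W: "subspace W" and YW: "\<not> Y \<subseteq> W"
  shows "card {Z. subspace Z \<and> covers s Y Z \<and> Z \<subseteq> W} = card {Z. subspace Z \<and> covers s Z W \<and> Y \<subseteq> Z}"
proof -
  let ?S = "{x + y | x y. x \<in> Y \<and> y \<in> W}"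
  have sub: "subspace (Y \<inter> W)" "subspace ?S" using Y W subspace_inter subspace_sums by auto
  have dim: "dm ?S + dm (Y \<inter> W) = dm Y + dm W"
    using dim_sums_Int[OF Y W] .
  have up: "Y \<subseteq> ?S" "W \<subseteq> ?S"
    using subspace_0[OF Y] subspace_0[OF W] by force+
  have least: "?S \<subseteq> Z" if "subspace Z" "Y \<subseteq> Z" "W \<subseteq> Z" for Z
    using that subspace_add by blast
  have Y': "Y \<inter> W \<subset> Y" and W': "W \<subset> ?S" using YW up by auto
  have 1: "dm (Y \<inter> W) < dm Y" "dm W < dm ?S"
    using dim_less_if_psubset sub Y W Y' W' by auto
  have lower: "Z = Y \<inter> W \<and> dm Y = dm (Y \<inter> W) + 1" if "subspace Z" "covers s Y Z" "Z \<subseteq> W" for Z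
  proof -
    have "Z \<subseteq> Y \<inter> W" "dm (Y \<inter> W) \<le> dm Z"
      using that 1 by (auto simp: covers_def)
    then show ?thesis
      using subspace_dim_equal[OF that(1) sub(1)] that(2) by (auto simp: covers_def)
  qed
  have upper: "Z = ?S \<and> dm ?S = dm W + 1" if "subspace Z" "covers s Z W" "Y \<subseteq> Z" for Z
  proof -
    have "?S \<subseteq> Z"
      using that least by (meson covers_def)
    moreover have "dm Z \<le> dm ?S"
      using that 1 unfolding covers_def by linarith
    ultimately show ?thesis
      using subspace_dim_equal[OF sub(2) that(1)] that(2) unfolding covers_def by metis
  qed
  have iff: "dm Y = dm (Y \<inter> W) + 1 \<longleftrightarrow> dm ?S = dm W + 1"
    using dim by linarith
  show ?thesis
  proof (cases "dm Y = dm (Y \<inter> W) + 1")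
    case True
    then have "covers s Y (Y \<inter> W)" "covers s ?S W"
      using iff up(2) unfolding covers_def by (blast, metis)
    then have "{Z. subspace Z \<and> covers s Y Z \<and> Z \<subseteq> W} = {Y \<inter> W}"
      and "{Z. subspace Z \<and> covers s Z W \<and> Y \<subseteq> Z} = {?S}"
      using lower upper sub up by blast+
    then show ?thesis by simp
  next
    case False
    then have "{Z. subspace Z \<and> covers s Y Z \<and> Z \<subseteq> W} = {}"
      and "{Z. subspace Z \<and> covers s Z W \<and> Y \<subseteq> Z} = {}"
      using lower upper iff by blast+
    then show ?thesis by (simp only:)
  qed
qed

end


section \<open>Action of both matrices on the vectors \<open>f\<^sub>W\<close>\<close>

lemma sum_if_const:
  "(\<Sum>z\<in>(UNIV :: 'b::finite set). if P z then k else 0) = of_nat (card {z. P z}) * (k :: complex)"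
  by (simp add: sum.If_cases)

locale subspace_lattice = finite_field_space s B
  for s :: "'a::{field,finite} \<Rightarrow> 'v::ab_group_add \<Rightarrow> 'v" and B +
  fixes U :: "'x::finite \<Rightarrow> 'v set" and q N :: nat
  assumes bij_U: "bij_betw U UNIV (subspaces s)"
    and card_field: "CARD('a) = q"
    and dim_UNIV_N: "dm UNIV = N"
begin

abbreviation "d x \<equiv> dm (U x)"

definition down_vec :: "complex \<Rightarrow> 'x \<Rightarrow> complex ^ 'x" where
  "down_vec a W = (\<chi> y. if U y \<subseteq> U W then a ^ d y else 0)"

lemma subspace_U: "subspace (U x)"
  using bij_U by (auto simp: bij_betw_def subspaces_def)

lemma card_U: "card {x. P (U x)} = card {Z. subspace Z \<and> P Z}"
proof -
  have "U ` {x. P (U x)} = {Z. subspace Z \<and> P Z}"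
  proof safe
    fix Z assume "subspace Z" "P Z"
    moreover from this obtain x where "Z = U x"
      using bij_U unfolding bij_betw_def subspaces_def by blast
    ultimately show "Z \<in> U ` {x. P (U x)}" by blast
  qed (rule subspace_U)
  moreover have "inj_on U {x. P (U x)}"
    using bij_U unfolding bij_betw_def by (blast intro: inj_on_subset)
  ultimately have "bij_betw U {x. P (U x)} {Z. subspace Z \<and> P Z}"
    unfolding bij_betw_def by blast
  then show ?thesis by (rule bij_betw_same_card)
qed

lemma U_eq_iff: "U x = U y \<longleftrightarrow> x = y"
  using bij_U by (auto simp: bij_betw_def inj_on_def)

lemma d_le_N: "d x \<le> N"
  unfolding dim_UNIV_N[symmetric] by (rule dim_subset) auto

lemma q_ge_2: "q \<ge> 2"
  using card_field_ge_2 card_field by simp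

lemma card_upper_covers_U:
  assumes "subspace S" "U y \<subseteq> S"
  shows "of_nat (card {z. covers s (U z) (U y) \<and> U z \<subseteq> S}) = (of_nat q ^ (dm S - d y) - 1) / (of_nat q - 1 :: complex)"
proof -
  have "card {z. covers s (U z) (U y) \<and> U z \<subseteq> S}
    = card {Z. subspace Z \<and> U y \<subseteq> Z \<and> Z \<subseteq> S \<and> dm Z = d y + 1}"
    using card_U[of "\<lambda>Z. covers s Z (U y) \<and> Z \<subseteq> S"] by (simp add: covers_def conj_ac)
  then have "complex_of_real (real (card {z. covers s (U z) (U y) \<and> U z \<subseteq> S}) * (real q - 1))
    = complex_of_real (real q ^ (dm S - d y) - 1)"
    using card_upper_covers[OF subspace_U assms] by (simp add: card_field)
  then show ?thesis
    using q_ge_2 by (simp add: field_simps)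
qed

lemma card_lower_covers_U:
  assumes "subspace S" "S \<subseteq> U y"
  shows "of_nat (card {z. covers s (U y) (U z) \<and> S \<subseteq> U z}) = (of_nat q ^ (d y - dm S) - 1) / (of_nat q - 1 :: complex)"
proof -
  have "card {z. covers s (U y) (U z) \<and> S \<subseteq> U z}
    = card {Z. subspace Z \<and> S \<subseteq> Z \<and> Z \<subseteq> U y \<and> d y = dm Z + 1}"
    using card_U[of "\<lambda>Z. covers s (U y) Z \<and> S \<subseteq> Z"] by (simp add: covers_def conj_ac)
  then have "complex_of_real (real (card {z. covers s (U y) (U z) \<and> S \<subseteq> U z}) * (real q - 1))
    = complex_of_real (real q ^ (d y - dm S) - 1)"
    using card_lower_covers[OF assms(1) subspace_U assms(2)] by (simp add: card_field)
  then show ?thesis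
    using q_ge_2 by (simp add: field_simps)
qed

lemma sum_down_vec_nth:
  "(\<Sum>W\<in>{W. P W}. down_vec a W) $ y = of_nat (card {W. P W \<and> U y \<subseteq> U W}) * a ^ d y"
proof -
  have "(\<Sum>W\<in>{W. P W}. down_vec a W) $ y = (\<Sum>W\<in>UNIV. if P W \<and> U y \<subseteq> U W then a ^ d y else 0)"
    unfolding sum_component down_vec_def
    by (intro sum.mono_neutral_cong_left) auto
  then show ?thesis by (simp only: sum_if_const)
qed

text \<open>For \<open>U y \<subseteq> U W\<close> the entry combines powers of \<open>q\<close>
  with exponents \<open>d W\<close>, \<open>d y\<close> and 0. The coefficient of
  \<open>q ^ d y\<close> is a multiple of \<open>1 / a - \<phi> * a + \<phi> - 1\<close>, which the
  quadratic equation makes zero. The constant term splits into the \<open>q ^ (N - d W)\<close> part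
  of the eigenvalue and the number of covers of \<open>W\<close>.\<close>

lemma A_mat_down_vec:
  assumes a: "a \<noteq> 0" "of_real \<phi> * a\<^sup>2 = (of_real \<phi> - 1) * a + 1"
  shows "A_mat s U q \<phi> *v down_vec a W =
    ((of_real \<phi> * a * of_nat q ^ d W - of_nat q ^ (N - d W) / a) / (of_nat q - 1)) *s down_vec a W
    + (1 / a) *s (\<Sum>W'\<in>{W'. covers s (U W') (U W)}. down_vec a W')"
proof (rule vec_eq_iff[THEN iffD2], rule allI)
  fix y
  define c where "c = (of_real \<phi> - 1) / (of_nat q - 1 :: complex)"
  \<comment> \<open>The summands belong to the subspaces covered by \<open>y\<close>, the covers of
    \<open>y\<close>, and \<open>y\<close> itself; \<open>a ^ d z\<close> is rewritten in terms of
    \<open>a ^ d y\<close>.\<close>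
  have entry: "A_mat s U q \<phi> $ y $ z * down_vec a W $ z =
     (if covers s (U y) (U z) \<and> U z \<subseteq> U W then a ^ d y / a else 0)
   + (if covers s (U z) (U y) \<and> U z \<subseteq> U W then of_real \<phi> * of_nat q ^ d y * a ^ d y * a else 0)
   + (if y = z then (if U y \<subseteq> U W then c * of_nat q ^ d y * a ^ d y else 0) else 0)" for z
    using a by (auto simp: A_mat_def down_vec_def covers_def c_def)
  have L: "(A_mat s U q \<phi> *v down_vec a W) $ y =
      of_nat (card {z. covers s (U y) (U z) \<and> U z \<subseteq> U W}) * (a ^ d y / a)
    + of_nat (card {z. covers s (U z) (U y) \<and> U z \<subseteq> U W}) * (of_real \<phi> * of_nat q ^ d y * a ^ d y * a)
    + (if U y \<subseteq> U W then c * of_nat q ^ d y * a ^ d y else 0)"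
    unfolding matrix_vector_mult_def vec_lambda_beta entry sum.distrib sum_if_const
    by (simp add: sum.delta)
  have Q: "of_nat q - 1 \<noteq> (0::complex)" using q_ge_2 by simp
  show "(A_mat s U q \<phi> *v down_vec a W) $ y = (((of_real \<phi> * a * of_nat q ^ d W - of_nat q ^ (N - d W) / a) / (of_nat q - 1)) *s down_vec a W
    + (1 / a) *s (\<Sum>W'\<in>{W'. covers s (U W') (U W)}. down_vec a W')) $ y"
  proof (cases "U y \<subseteq> U W")
    case True
    have "{z. covers s (U y) (U z) \<and> U z \<subseteq> U W} = {z. covers s (U y) (U z) \<and> {0} \<subseteq> U z}"
      using True subspace_0[OF subspace_U] by (auto simp: covers_def)
    then have n1: "of_nat (card {z. covers s (U y) (U z) \<and> U z \<subseteq> U W}) = (of_nat q ^ d y - 1) / (of_nat q - 1 :: complex)"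
      using card_lower_covers_U[of "{0}" y] subspace_0[OF subspace_U] by simp
    note n2 = card_upper_covers_U[OF subspace_U True]
    have "{W'. covers s (U W') (U W) \<and> U y \<subseteq> U W'} = {W'. covers s (U W') (U W) \<and> U W' \<subseteq> UNIV}"
      using True by (auto simp: covers_def)
    then have n3: "of_nat (card {W'. covers s (U W') (U W) \<and> U y \<subseteq> U W'}) = (of_nat q ^ (N - d W) - 1) / (of_nat q - 1 :: complex)"
      using card_upper_covers_U[of UNIV W] by (simp only: dim_UNIV_N subspace_UNIV subset_UNIV)
    have "d y \<le> d W" using True by (rule dim_subset)
    then have pow: "(of_nat q :: complex) ^ d W = of_nat q ^ d y * of_nat q ^ (d W - d y)"
      by (simp flip: power_add)
    \<comment> \<open>Here \<open>x\<close>, \<open>r\<close>, \<open>t\<close> are the powers of \<open>q\<close> with exponents \<open>dim y\<close>, \<open>dim W - dim y\<close>, \<open>N - dim W\<close>,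
      \<open>p\<close> is \<open>a ^ dim y\<close> and \<open>f\<close> is \<open>\<phi>\<close>.\<close>
    have core: "(x - 1) * (p / a) + (r - 1) * (f * x * p * a) + (f - 1) * x * p
      = (f * a * (x * r) - t / a) * p + (1 / a) * ((t - 1) * p)"
      if "f * a\<^sup>2 = (f - 1) * a + 1" for x p r f t :: complex
    proof -
      have "((x - 1) * (p / a) + (r - 1) * (f * x * p * a) + (f - 1) * x * p) * a
        = (x - 1) * p + (r - 1) * x * p * (f * a\<^sup>2) + (f - 1) * x * p * a"
        using a by (simp add: field_simps power2_eq_square)
      also have "\<dots> = (f * a\<^sup>2) * x * r * p - t * p + (t - 1) * p"
        unfolding that by (simp add: algebra_simps)
      also have "\<dots> = ((f * a * (x * r) - t / a) * p + (1 / a) * ((t - 1) * p)) * a"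
        using a by (simp add: field_simps power2_eq_square)
      finally show ?thesis using a by simp
    qed
    show ?thesis
      unfolding L n1 n2 vector_add_component vector_smult_component sum_down_vec_nth n3
      using core[OF a(2), of "of_nat q ^ d y" "a ^ d y" "of_nat q ^ (d W - d y)" "of_nat q ^ (N - d W)"] Q True
      unfolding c_def pow by (simp add: down_vec_def divide_simps)
  next
    case False
    \<comment> \<open>A cover of \<open>y\<close> inside \<open>U W\<close> would place
      \<open>y\<close> there too, so only the subspaces covered by \<open>y\<close>
      contribute.\<close>
    then have "{z. covers s (U z) (U y) \<and> U z \<subseteq> U W} = {}"
      by (auto simp: covers_def)
    moreover have "card {z. covers s (U y) (U z) \<and> U z \<subseteq> U W} = card {W'. covers s (U W') (U W) \<and> U y \<subseteq> U W'}"
      using card_covers_transfer[OF subspace_U subspace_U False] by (subst (1 2) card_U)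
    ultimately show ?thesis
      unfolding L vector_add_component vector_smult_component sum_down_vec_nth
      using False by (simp add: down_vec_def)
  qed
qed

text \<open>For \<open>U y \<subseteq> U W\<close> and \<open>e = d W - d y\<close>, write
  \<open>q ^ e\<close> as \<open>1 + (q ^ e - 1)\<close>; the bracket is \<open>q - 1\<close> times
  the number of hyperplanes of \<open>U W\<close> containing \<open>U y\<close>.\<close>

lemma A_dual_down_vec:
  "A_dual s U q *v down_vec a W = (1 / of_nat q ^ d W) *s
    (down_vec a W + (of_nat q - 1) *s (\<Sum>W'\<in>{W'. covers s (U W) (U W')}. down_vec a W'))"
proof (rule vec_eq_iff[THEN iffD2], rule allI)
  fix y
  have L: "(A_dual s U q *v down_vec a W) $ y = down_vec a W $ y / of_nat q ^ d y"
    unfolding matrix_vector_mult_def A_dual_def vec_lambda_beta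
    by (simp add: if_distrib[of "\<lambda>x. x * _"] cong: if_cong)
  have Q: "of_nat q - 1 \<noteq> (0::complex)" "of_nat q \<noteq> (0::complex)" using q_ge_2 by auto
  show "(A_dual s U q *v down_vec a W) $ y = ((1 / of_nat q ^ d W) *s
    (down_vec a W + (of_nat q - 1) *s (\<Sum>W'\<in>{W'. covers s (U W) (U W')}. down_vec a W'))) $ y"
  proof (cases "U y \<subseteq> U W")
    case True
    have "d y \<le> d W" using True by (rule dim_subset)
    then have pow: "(of_nat q :: complex) ^ d W = of_nat q ^ d y * of_nat q ^ (d W - d y)"
      by (simp flip: power_add)
    show ?thesis
      unfolding L vector_add_component vector_smult_component sum_down_vec_nth card_lower_covers_U[OF subspace_U True] pow
      using Q True by (simp add: down_vec_def field_simps)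
  next
    case False
    then have "{W'. covers s (U W) (U W') \<and> U y \<subseteq> U W'} = {}"
      by (auto simp: covers_def)
    then show ?thesis
      unfolding L vector_add_component vector_smult_component sum_down_vec_nth
      using False by (simp add: down_vec_def)
  qed
qed

text \<open>The vectors are triangular with respect to inclusion, with nonzero diagonal entries
  \<open>a ^ d x\<close>; induction on the dimension recovers the unit vectors.\<close>

lemma span_down_vec:
  assumes "a \<noteq> 0"
  shows "vec.span (range (down_vec a)) = UNIV"
proof -
  have ax: "axis x 1 \<in> vec.span (range (down_vec a))" for x :: 'x
  proof (induction "d x" arbitrary: x rule: less_induct)
    case less
    let ?S = "{z. U z \<subset> U x}"
    have "down_vec a x = a ^ d x *s axis x 1 + (\<Sum>z\<in>?S. a ^ d z *s axis z 1)"
    proof (rule vec_eq_iff[THEN iffD2], rule allI)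
      fix y
      have "(\<Sum>z\<in>?S. a ^ d z *s axis z 1) $ y = (\<Sum>z\<in>?S. if y = z then a ^ d z else 0)"
        unfolding sum_component by (intro sum.cong) (auto simp: axis_def)
      also have "\<dots> = (if y \<in> ?S then a ^ d y else 0)"
        by (subst sum.delta') auto
      finally have sum_eq: "(\<Sum>z\<in>?S. a ^ d z *s axis z 1) $ y = (if y \<in> ?S then a ^ d y else 0)" .
      then show "down_vec a x $ y = (a ^ d x *s axis x 1 + (\<Sum>z\<in>?S. a ^ d z *s axis z 1)) $ y"
        unfolding vector_add_component sum_eq
        using U_eq_iff[of y x] by (simp add: down_vec_def axis_def psubset_eq)
    qed
    then have "axis x 1 = (1 / a ^ d x) *s (down_vec a x - (\<Sum>z\<in>?S. a ^ d z *s axis z 1))"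
      using assms by (simp add: vec.scale_scale)
    moreover have "axis z 1 \<in> vec.span (range (down_vec a))" if "z \<in> ?S" for z
      using that less dim_less_if_psubset subspace_U by blast
    then have "(1 / a ^ d x) *s (down_vec a x - (\<Sum>z\<in>?S. a ^ d z *s axis z 1)) \<in> vec.span (range (down_vec a))"
      by (intro vec.span_scale vec.span_diff vec.span_sum vec.span_base[OF rangeI])
    ultimately show ?case
      by (simp only:)
  qed
  have "v \<in> vec.span (range (down_vec a))" for v
  proof -
    have "v = (\<Sum>x\<in>UNIV. v $ x *s axis x 1)"
      by (simp add: basis_expansion)
    also have "\<dots> \<in> vec.span (range (down_vec a))"
      by (intro vec.span_sum vec.span_scale ax)
    finally show ?thesis .
  qed
  then show ?thesis by auto
qed

section \<open>The flags and how far the two matrices move them\<close>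

definition flag :: "complex \<Rightarrow> nat \<Rightarrow> (complex ^ 'x) set" where
  "flag a k = vec.span (down_vec a ` {W. k \<le> d W})"

lemma flag_0: "a \<noteq> 0 \<Longrightarrow> flag a 0 = UNIV"
  using span_down_vec by (simp add: flag_def)

lemma flag_Suc_N: "flag a (Suc N) \<subseteq> {0}"
proof -
  have "{W. Suc N \<le> d W} = {}" using d_le_N by (auto simp: not_less_eq_eq)
  then show ?thesis unfolding flag_def by simp
qed

lemma down_vec_in_flag: "k \<le> d W \<Longrightarrow> down_vec a W \<in> flag a k"
  by (auto simp: flag_def intro: vec.span_base)

lemma subspace_flag: "vec.subspace (flag a k)"
  by (simp add: flag_def)

text \<open>Generators of dimension above \<open>k\<close> and all their covers lie in
  \<open>flag a (Suc k)\<close>; for dimension \<open>k\<close> the subtracted scalar cancels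
  \<open>f\<^sub>W\<close> itself, leaving only covers.\<close>

lemma A_mat_flag:
  assumes a: "a \<noteq> 0" "of_real \<phi> * a\<^sup>2 = (of_real \<phi> - 1) * a + 1" and v: "v \<in> flag a k"
  shows "A_mat s U q \<phi> *v v - ((of_real \<phi> * a * of_nat q ^ k - of_nat q ^ (N - k) / a) / (of_nat q - 1)) *s v
    \<in> flag a (Suc k)"
  using v unfolding flag_def[of a k]
proof (induction rule: vec.span_induct_alt)
  case base
  then show ?case by (simp add: flag_def vec.span_zero)
next
  case (step c x y)
  define l where "l k = (of_real \<phi> * a * of_nat q ^ k - of_nat q ^ (N - k) / a) / (of_nat q - 1)" for k
  from step obtain W where W: "x = down_vec a W" "k \<le> d W" by auto
  have "A_mat s U q \<phi> *v x - l k *s x = (l (d W) - l k) *s down_vec a W + (1 / a) *s (\<Sum>W'\<in>{W'. covers s (U W') (U W)}. down_vec a W')"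
    unfolding W(1) A_mat_down_vec[OF a] l_def[symmetric] by (simp add: vec.scale_left_diff_distrib)
  moreover have "(l (d W) - l k) *s down_vec a W \<in> flag a (Suc k)"
  proof (cases "k = d W")
    case True
    then show ?thesis using subspace_flag by (simp add: vec.subspace_0)
  next
    case False
    then show ?thesis
      using W(2) by (intro vec.subspace_scale subspace_flag down_vec_in_flag) auto
  qed
  moreover have "(1 / a) *s (\<Sum>W'\<in>{W'. covers s (U W') (U W)}. down_vec a W') \<in> flag a (Suc k)"
    using W(2) by (intro vec.subspace_scale vec.subspace_sum subspace_flag down_vec_in_flag) (auto simp: covers_def)
  ultimately have x: "A_mat s U q \<phi> *v x - l k *s x \<in> flag a (Suc k)"
    using subspace_flag by (metis vec.subspace_add)
  have "A_mat s U q \<phi> *v (c *s x + y) - l k *s (c *s x + y)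
    = c *s (A_mat s U q \<phi> *v x - l k *s x) + (A_mat s U q \<phi> *v y - l k *s y)"
    by (simp add: matrix_vector_right_distrib vec.scale vec.scale_right_diff_distrib vec.scale_right_distrib vec.scale_scale mult.commute)
  then show ?case
    using x step(2) subspace_flag unfolding l_def by (metis vec.subspace_add vec.subspace_scale)
qed

text \<open>Passing to a covered subspace lowers the dimension by one. For \<open>k = 0\<close> the
  subtraction truncates and the flag stays at its first member.\<close>

lemma A_dual_flag:
  assumes v: "v \<in> flag a k"
  shows "A_dual s U q *v v \<in> flag a (k - 1)"
  using v unfolding flag_def[of a k]
proof (induction rule: vec.span_induct_alt)
  case base
  then show ?case by (simp add: flag_def vec.span_zero)
next
  case (step c x y)
  then obtain W where W: "x = down_vec a W" "k \<le> d W" by auto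
  have "A_dual s U q *v x \<in> flag a (k - 1)"
    unfolding W(1) A_dual_down_vec using W(2)
    by (intro vec.subspace_scale vec.subspace_add vec.subspace_sum subspace_flag down_vec_in_flag) (auto simp: covers_def)
  then show ?case
    using step(2) subspace_flag
    by (simp add: matrix_vector_right_distrib vec.scale vec.subspace_add vec.subspace_scale)
qed

end

section \<open>Eigenvectors and flags for distinct eigenvalues\<close>

text \<open>
  If \<open>M v - \<lambda>\<^sub>k v\<close> is a sum of eigenvectors \<open>u\<^sub>j\<close>, then subtracting \<open>u\<^sub>j / (\<lambda>\<^sub>j - \<lambda>\<^sub>k)\<close> from \<open>v\<close> leaves an
  eigenvector for \<open>\<lambda>\<^sub>k\<close>.
\<close>

lemma flag_eigenvector_decomposition:
  fixes M :: "complex ^ 'x ^ 'x::finite"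
  assumes step: "\<And>k v. k \<le> N \<Longrightarrow> v \<in> V k \<Longrightarrow> M *v v - lam k *s v \<in> V (Suc k)"
    and top: "V (Suc N) \<subseteq> {0}" and inj: "inj_on lam {..N}"
    and k: "k \<le> Suc N" and v: "v \<in> V k"
  shows "\<exists>u. (\<forall>j\<in>{k..N}. u j \<in> eigenspace M (lam j)) \<and> v = (\<Sum>j=k..N. u j)"
  using k v
proof (induction arbitrary: v rule: inc_induct)
  case base
  then show ?case using top by auto
next
  case (step k)
  then have "M *v v - lam k *s v \<in> V (Suc k)"
    using assms(1) by simp
  then obtain u where u: "\<And>j. j \<in> {Suc k..N} \<Longrightarrow> u j \<in> eigenspace M (lam j)"
      "M *v v - lam k *s v = (\<Sum>j=Suc k..N. u j)"
    using step.IH by blast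
  define w where "w j = (1 / (lam j - lam k)) *s u j" for j
  have w: "M *v w j = lam j *s w j" "(lam j - lam k) *s w j = u j" if "j \<in> {Suc k..N}" for j
  proof -
    show "M *v w j = lam j *s w j"
      using u(1)[OF that] by (simp add: w_def eigenspace_def vec.scale vec.scale_scale mult.commute)
    have "lam j \<noteq> lam k" using inj_onD[OF inj, of j k] that by auto
    then show "(lam j - lam k) *s w j = u j" by (simp add: w_def vec.scale_scale)
  qed
  define v' where "v' = v - (\<Sum>j=Suc k..N. w j)"
  have "M *v (\<Sum>j=Suc k..N. w j) - lam k *s (\<Sum>j=Suc k..N. w j) = (\<Sum>j=Suc k..N. (lam j - lam k) *s w j)"
    using w(1) by (simp add: vec.sum vec.scale_sum_right vec.scale_left_diff_distrib sum_subtractf)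
  also have "\<dots> = M *v v - lam k *s v"
    using w(2) u(2) by simp
  finally have v': "M *v v' = lam k *s v'"
    unfolding v'_def by (simp add: vec.diff vec.scale_right_diff_distrib algebra_simps)
  define u' where "u' j = (if j = k then v' else w j)" for j
  have "v = (\<Sum>j=k..N. u' j)"
    using step.hyps by (simp add: sum.atLeast_Suc_atMost u'_def v'_def)
  moreover have "\<forall>j\<in>{k..N}. u' j \<in> eigenspace M (lam j)"
    using v' w(1) by (auto simp: u'_def eigenspace_def)
  ultimately show ?case by blast
qed

text \<open>An eigenvector for \<open>lam j\<close> climbs the flag: from level \<open>l < j\<close>
  the step puts \<open>(lam j - lam l) *s v\<close> into the next level, and the factor is
  invertible.\<close>

lemma eigenspace_subset_flag:
  fixes M :: "complex ^ 'x ^ 'x::finite"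
  assumes step: "\<And>k v. k \<le> N \<Longrightarrow> v \<in> V k \<Longrightarrow> M *v v - lam k *s v \<in> V (Suc k)"
    and bottom: "V 0 = UNIV" and sub: "\<And>k. vec.subspace (V k)" and inj: "inj_on lam {..N}"
    and j: "j \<le> N" and v: "v \<in> eigenspace M (lam j)" and l: "l \<le> j"
  shows "v \<in> V l"
  using l
proof (induction l)
  case 0
  then show ?case using bottom by simp
next
  case (Suc l)
  then have "M *v v - lam l *s v \<in> V (Suc l)"
    using step[of l v] j by simp
  then have "(lam j - lam l) *s v \<in> V (Suc l)"
    using v by (simp add: eigenspace_def vec.scale_left_diff_distrib)
  moreover have "lam j - lam l \<noteq> 0"
    using inj_onD[OF inj, of j l] Suc.prems j by auto
  ultimately show ?case
    using vec.subspace_scale[OF sub, of "(lam j - lam l) *s v" _ "1 / (lam j - lam l)"]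
    by (simp only: vec.scale_scale) simp
qed

text \<open>As the eigenvalues are distinct, \<open>P\<close> kills every \<open>u j\<close> with
  \<open>j \<noteq> l\<close>. The case of \<open>l\<close> outside \<open>J\<close> will show that
  components vanish.\<close>

lemma eigenprojection_sum:
  fixes M :: "complex ^ 'x ^ 'x::finite"
  assumes P: "eigenprojection M (lam l) P"
    and inj: "inj_on lam I" and J: "J \<subseteq> I" "l \<in> I" "finite J"
    and u: "\<forall>j\<in>J. u j \<in> eigenspace M (lam j)"
  shows "P *v (\<Sum>j\<in>J. u j) = (if l \<in> J then u l else 0)"
proof -
  have "P *v u j = (if l = j then u j else 0)" if "j \<in> J" for j
    using P u that inj_onD[OF inj, of j l] J unfolding eigenprojection_def
    by (smt (verit, best) subsetD)
  then have "P *v (\<Sum>j\<in>J. u j) = (\<Sum>j\<in>J. if l = j then u j else 0)"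
    by (simp add: vec.sum)
  then show ?thesis using J by simp
qed

lemma strict_antimono_theta:
  assumes "\<phi> > 0" "q \<ge> 2" "i < j" "j \<le> N"
  shows "theta q \<phi> N j < theta q \<phi> N i"
proof -
  have "real q ^ i < real q ^ j" "real q ^ (N - j) < real q ^ (N - i)"
    using assms by (auto intro!: power_strict_increasing)
  then have "\<phi> * real q ^ (N - j) - real q ^ j < \<phi> * real q ^ (N - i) - real q ^ i"
    using assms by (smt (verit) mult_strict_left_mono)
  then show ?thesis
    using assms by (simp add: theta_def divide_strict_right_mono)
qed

lemma inj_on_theta:
  assumes "\<phi> > 0" "q \<ge> 2"
  shows "inj_on (\<lambda>i. complex_of_real (theta q \<phi> N i)) {..N}"
  using strict_antimono_theta[OF assms]
  by (intro linorder_inj_onI') (force simp: less_le)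


section \<open>Intersecting the bounds from the two flags\<close>

theorem proposition12p3:
  fixes s :: "'a::{field,finite} \<Rightarrow> 'v::ab_group_add \<Rightarrow> 'v"
    and B :: "'v set"
    and U :: "'x::finite \<Rightarrow> 'v set"
    and E :: "int \<Rightarrow> complex ^ 'x ^ 'x"
    and q N i :: nat
    and \<phi> :: real
  assumes "CARD('a) = q"
    and "finite_dimensional_vector_space s B"
    and "vector_space.dim s (UNIV :: 'v set) = N"
    and "N \<ge> 1"
    and "bij_betw U UNIV (subspaces s)"
    and "\<phi> > 0"
    and "\<And>j. j \<le> N \<Longrightarrow> eigenprojection (A_mat s U q \<phi>) (of_real (theta q \<phi> N j)) (E (int j))"
    and "E (-1) = 0"
    and "E (int N + 1) = 0"
    and "i \<le> N"
  shows "(*v) (A_dual s U q) ` range ((*v) (E (int i)))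
    \<subseteq> range ((*v) (E (int i - 1))) + range ((*v) (E (int i))) + range ((*v) (E (int i + 1)))"
proof -
  interpret subspace_lattice s B U q N
    using assms(1-3,5) by (simp add: subspace_lattice_def finite_field_space_def subspace_lattice_axioms_def)
  let ?A = "A_mat s U q \<phi>" and ?Y = "A_dual s U q"
  define lam where "lam j = complex_of_real (theta q \<phi> N j)" for j
  \<comment> \<open>The flag for \<open>a = 1\<close> meets the eigenvalues in reverse
    order.\<close>
  define lam' where "lam' k = lam (N - k)" for k
  define b where "b = - 1 / complex_of_real \<phi>"
  have phi: "complex_of_real \<phi> \<noteq> 0" using assms(6) by simp
  have b: "b \<noteq> 0" "of_real \<phi> * b\<^sup>2 = (of_real \<phi> - 1) * b + 1"
    using phi by (auto simp: b_def field_simps power2_eq_square)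
  have one: "(1::complex) \<noteq> 0" "of_real \<phi> * (1::complex)\<^sup>2 = (of_real \<phi> - 1) * 1 + 1"
    by auto
  have flag_1: "?A *v v - lam' k *s v \<in> flag 1 (Suc k)" if "k \<le> N" "v \<in> flag 1 k" for k v
    using A_mat_flag[OF one that(2)] that(1) by (simp add: lam'_def lam_def theta_def)
  \<comment> \<open>Here \<open>\<phi> * b = - 1\<close> and \<open>- 1 / b = \<phi>\<close>, so the
    scalar of \<open>A_mat_flag\<close> becomes \<open>theta q \<phi> N k\<close>.\<close>
  have flag_b: "?A *v v - lam k *s v \<in> flag b (Suc k)" if "k \<le> N" "v \<in> flag b k" for k v
    using A_mat_flag[OF b that(2)] phi by (simp add: lam_def theta_def b_def mult.commute)
  have inj: "inj_on lam {..N}"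
    using inj_on_theta[OF assms(6) q_ge_2] by (simp add: lam_def[abs_def])
  have inj': "inj_on lam' {..N}"
  proof (rule inj_onI)
    fix j k assume "j \<in> {..N}" "k \<in> {..N}" "lam' j = lam' k"
    then show "j = k"
      using inj_onD[OF inj, of "N - j" "N - k"] by (auto simp: lam'_def)
  qed
  have proj: "eigenprojection ?A (lam j) (E (int j))" if "j \<le> N" for j
    using assms(7)[OF that] by (simp add: lam_def)
  have proj': "eigenprojection ?A (lam' (N - j)) (E (int j))" if "j \<le> N" for j
    using proj[OF that] that by (simp add: lam'_def)
  \<comment> \<open>An eigenprojection is prescribed only on eigenvectors; decomposing an arbitrary
    \<open>x\<close> along the flag for \<open>b\<close> determines
    \<open>E (int i) *v x\<close>.\<close>
  have E_eigen: "E (int i) *v x \<in> eigenspace ?A (lam i)" for x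
  proof -
    obtain u where u: "\<forall>j\<in>{0..N}. u j \<in> eigenspace ?A (lam j)" "x = (\<Sum>j=0..N. u j)"
      using flag_eigenvector_decomposition[OF flag_b flag_Suc_N inj, of 0 x] flag_0[OF b(1)] by auto
    have "E (int i) *v x = (if i \<in> {0..N} then u i else 0)"
      unfolding u(2)
      by (rule eigenprojection_sum[OF proj[OF assms(10)] inj _ _ _ u(1)]) (use assms(10) in auto)
    then show ?thesis using u(1) assms(10) by simp
  qed
  show ?thesis
  proof safe
    fix x
    define z where "z = ?Y *v (E (int i) *v x)"
    define T where "T j = E j *v z" for j
    have "E (int i) *v x \<in> flag b i"
      by (rule eigenspace_subset_flag[OF flag_b flag_0[OF b(1)] subspace_flag inj assms(10) E_eigen order_refl])
    \<comment> \<open>This bounds the indices of the components of \<open>z\<close> from below by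
      \<open>i - 1\<close>.\<close>
    then have zb: "z \<in> flag b (i - 1)"
      unfolding z_def by (rule A_dual_flag)
    have "i - 1 \<le> Suc N" using assms(10) by simp
    then obtain u where u: "\<forall>j\<in>{i - 1..N}. u j \<in> eigenspace ?A (lam j)" "z = (\<Sum>j=i - 1..N. u j)"
      using flag_eigenvector_decomposition[OF flag_b flag_Suc_N inj _ zb] by metis
    have T_u: "T (int j) = (if j \<in> {i - 1..N} then u j else 0)" if "j \<le> N" for j
      unfolding T_def u(2)
      by (rule eigenprojection_sum[OF proj[OF that] inj _ _ _ u(1)]) (use that in auto)
    have eig: "E (int i) *v x \<in> eigenspace ?A (lam' (N - i))"
      using E_eigen[of x] assms(10) by (simp add: lam'_def)
    have "E (int i) *v x \<in> flag 1 (N - i)"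
      by (rule eigenspace_subset_flag[OF flag_1 flag_0[OF one(1)] subspace_flag inj' diff_le_self eig order_refl])
    \<comment> \<open>In the reversed order, levels from \<open>N - i - 1\<close> on are the indices
      up to \<open>i + 1\<close>. For \<open>i = N\<close> truncation gives level 0, where every
      index is at most \<open>i\<close> anyway.\<close>
    then have z1: "z \<in> flag 1 (N - i - 1)"
      unfolding z_def by (rule A_dual_flag)
    have "N - i - 1 \<le> Suc N" by simp
    then obtain u' where u': "\<forall>j\<in>{N - i - 1..N}. u' j \<in> eigenspace ?A (lam' j)"
        "z = (\<Sum>j=N - i - 1..N. u' j)"
      using flag_eigenvector_decomposition[OF flag_1 flag_Suc_N inj' _ z1] by metis
    have T_0: "T (int j) = 0" if "j \<le> N" "j > i + 1" for j
    proof -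
      have "T (int j) = (if N - j \<in> {N - i - 1..N} then u' (N - j) else 0)"
        unfolding T_def u'(2)
        by (rule eigenprojection_sum[OF proj'[OF that(1)] inj' _ _ _ u'(1)]) auto
      then show ?thesis using that by simp
    qed
    have "z = (\<Sum>j=0..N. T (int j))"
      unfolding u(2) using T_u by (intro sum.mono_neutral_cong_left) auto
    also have "\<dots> = (\<Sum>j\<in>int ` {0..N}. T j)"
      by (simp add: sum.reindex)
    \<comment> \<open>The range is widened to contain \<open>int i - 1\<close> and
      \<open>int i + 1\<close> also for \<open>i = 0\<close> and \<open>i = N\<close>; the new terms
      vanish because \<open>E (-1)\<close> and \<open>E (int N + 1)\<close> are zero.\<close>
    also have "\<dots> = (\<Sum>j\<in>{-1..int N + 1}. T j)"
    proof (intro sum.mono_neutral_left ballI)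
      fix j assume "j \<in> {-1..int N + 1} - int ` {0..N}"
      then have "j = -1 \<or> j = int N + 1" by (auto simp: image_int_atLeastAtMost)
      then show "T j = 0" using assms(8,9) by (auto simp: T_def)
    qed auto
    also have "\<dots> = (\<Sum>j\<in>{int i - 1, int i, int i + 1}. T j)"
    proof (intro sum.mono_neutral_right ballI)
      fix j assume j: "j \<in> {-1..int N + 1} - {int i - 1, int i, int i + 1}"
      show "T j = 0"
      proof (cases "j = -1 \<or> j = int N + 1")
        case True
        then show ?thesis using assms(8,9) by (auto simp: T_def)
      next
        case False
        then obtain k where k: "j = int k" "k \<le> N"
          using j by (intro that[of "nat j"]) auto
        then have "k < i - 1 \<or> k > i + 1" using j by auto
        then show ?thesis using T_u[OF k(2)] T_0[OF k(2)] k(1) by auto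
      qed
    qed (use assms(10) in auto)
    also have "\<dots> = T (int i - 1) + T (int i) + T (int i + 1)"
      by simp
    finally have z_sum: "z = T (int i - 1) + T (int i) + T (int i + 1)" .
    have "T (int i - 1) + T (int i) + T (int i + 1)
      \<in> range ((*v) (E (int i - 1))) + range ((*v) (E (int i))) + range ((*v) (E (int i + 1)))"
      unfolding T_def by (intro set_plus_intro rangeI)
    then show "?Y *v (E (int i) *v x) \<in> range ((*v) (E (int i - 1))) + range ((*v) (E (int i))) + range ((*v) (E (int i + 1)))"
      unfolding z_sum[symmetric] z_def .
  qed
qed

end
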